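(* Let $R$ be a commutative ring with identity. (a) $R$ is a $\tau_z^{\Delta}$-atomic-HFR if and only if $\omega(\Gamma(R))\le2$. (b) $R$ is a $\tau_z$-atomic-HFR if and only if $R$ is reduced and $\omega(\Gamma(R))\le2$.
   Context: $U(R)$ is the group of units of $R$, $R^{\#}$ is the set of non-zero non-units, and $Z(R)$ is the set of zero-divisors (including $0$). The relations $\tau_z$ and $\tau_z^{\Delta}$ on $R^{\#}$ are $a\,\tau_z\,b\Leftrightarrow ab=0$ and $a\,\tau_z^{\Delta}\,b\Leftrightarrow (ab=0\text{ and }a\ne b)$. $\Gamma(R)$ is the simple graph with vertex set $Z(R)\setminus\{0\}$ in which distinct $a,b$ are adjacent iff $ab=0$. The clique number $\omega(\Gamma(R))$ is the largest integer $r\ge1$ such that $\Gamma(R)$ contains a complete subgraph on $r$ vertices ($\omega=0$ if $\Gamma(R)$ is empty), and $\infty$ if there are complete subgraphs of every size $r\ge1$. For a symmetric relation $\tau$ on $R^{\#}$ and a non-unit $a$, a $\tau$-factorization of $a$ of length $n$ is an expression $a=\lambda a_1\cdots a_n$ with $n\ge 1$, $\lambda\in U(R)$, $a_i\in R^{\#}$ and $a_i\,\tau\,a_j$ for all $i\ne j$. The factorizations $a=\lambda(\lambda^{-1}a)$ (the case $n=1$) are called trivial. $0$ may not occur as a factor of a non-trivial $\tau$-factorization, but the trivial factorizations $0=\lambda 0$ are allowed. A non-unit $a$ is a $\tau$-atom if for every $\tau$-factorization $a=\lambda a_1\cdots a_n$, $(a)=(a_i)$ for some $i$. A $\tau$-atomic-factorization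 is a $\tau$-factorization all of whose factors are $\tau$-atoms. $R$ is a $\tau$-atomic-HFR if every non-unit has a $\tau$-atomic-factorization and any two $\tau$-atomic-factorizations of the same non-unit have the same length. *)

theory Defs
  imports "HOL-Algebra.Ideal" "HOL-Library.Extended_Nat" "HOL-Library.Ramsey"
begin

definition nonunits :: "('a, 'm) ring_scheme \<Rightarrow> 'a set" where
  "nonunits R = carrier R - Units R"

definition nonzero_nonunits :: "('a, 'm) ring_scheme \<Rightarrow> 'a set" where
  "nonzero_nonunits R = nonunits R - {\<zero>\<^bsub>R\<^esub>}"

text \<open>Zero counts as a zero-divisor; inserting it explicitly only matters for the zero ring.\<close>

definition zero_divisors :: "('a, 'm) ring_scheme \<Rightarrow> 'a set" where
  "zero_divisors R =
     insert \<zero>\<^bsub>R\<^esub> {a \<in> carrier R. \<exists>b \<in> carrier R. b \<noteq> \<zero>\<^bsub>R\<^esub> \<and> a \<otimes>\<^bsub>R\<^esub> b = \<zero>\<^bsub>R\<^esub>}"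

definition reduced :: "('a, 'm) ring_scheme \<Rightarrow> bool" where
  "reduced R \<longleftrightarrow>
     (\<forall>a \<in> carrier R. \<forall>n::nat. a [^]\<^bsub>R\<^esub> n = \<zero>\<^bsub>R\<^esub> \<longrightarrow> a = \<zero>\<^bsub>R\<^esub>)"

definition tau_z :: "('a, 'm) ring_scheme \<Rightarrow> 'a rel" where
  "tau_z R = {(a, b). a \<in> nonzero_nonunits R \<and> b \<in> nonzero_nonunits R \<and>
                      a \<otimes>\<^bsub>R\<^esub> b = \<zero>\<^bsub>R\<^esub>}"

definition tau_z_Delta :: "('a, 'm) ring_scheme \<Rightarrow> 'a rel" where
  "tau_z_Delta R = {(a, b). a \<in> nonzero_nonunits R \<and> b \<in> nonzero_nonunits R \<and>
                            a \<otimes>\<^bsub>R\<^esub> b = \<zero>\<^bsub>R\<^esub> \<and> a \<noteq> b}"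

text \<open>
  A simple graph is a pair (V, E) whose edges are two-element subsets of V, as in the
  \<^const>\<open>clique\<close> predicate of the Ramsey theory.
\<close>

definition zero_divisor_graph :: "('a, 'm) ring_scheme \<Rightarrow> 'a set \<times> 'a set set" where
  "zero_divisor_graph R =
     (let V = zero_divisors R - {\<zero>\<^bsub>R\<^esub>}
      in (V, {{a, b} | a b. a \<in> V \<and> b \<in> V \<and> a \<noteq> b \<and> a \<otimes>\<^bsub>R\<^esub> b = \<zero>\<^bsub>R\<^esub>}))"

definition has_complete_subgraph :: "'v set \<times> 'v set set \<Rightarrow> nat \<Rightarrow> bool" where
  "has_complete_subgraph G r \<longleftrightarrow>
     (\<exists>C \<subseteq> fst G. finite C \<and> card C = r \<and> clique C (snd G))"

definition clique_number :: "'v set \<times> 'v set set \<Rightarrow> enat" where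
  "clique_number G =
     (if fst G = {} then 0
      else if \<forall>r\<ge>1. has_complete_subgraph G r then \<infinity>
      else enat (GREATEST r. 1 \<le> r \<and> has_complete_subgraph G r))"

text \<open>
  \<open>tau_factorization R \<tau> a u as\<close>: the unit \<open>u\<close> and the list of factors \<open>as\<close> form a
  \<open>\<tau>\<close>-factorization of the non-unit \<open>a\<close>, whose length is \<open>length as\<close>.  The second
  alternative for the factors admits the trivial factorizations of zero, which have the
  non-member zero of \<^term>\<open>nonzero_nonunits R\<close> as their only factor.
\<close>

definition tau_factorization ::
    "('a, 'm) ring_scheme \<Rightarrow> 'a rel \<Rightarrow> 'a \<Rightarrow> 'a \<Rightarrow> 'a list \<Rightarrow> bool" where
  "tau_factorization R \<tau> a u as \<longleftrightarrow>
     a \<in> nonunits R \<and> u \<in> Units R \<and> 1 \<le> length as \<and>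
     (set as \<subseteq> nonzero_nonunits R \<or> a = \<zero>\<^bsub>R\<^esub> \<and> as = [\<zero>\<^bsub>R\<^esub>]) \<and>
     (\<forall>i < length as. \<forall>j < length as. i \<noteq> j \<longrightarrow> (as ! i, as ! j) \<in> \<tau>) \<and>
     a = u \<otimes>\<^bsub>R\<^esub> foldr (\<otimes>\<^bsub>R\<^esub>) as \<one>\<^bsub>R\<^esub>"

definition tau_atom :: "('a, 'm) ring_scheme \<Rightarrow> 'a rel \<Rightarrow> 'a \<Rightarrow> bool" where
  "tau_atom R \<tau> a \<longleftrightarrow>
     a \<in> nonunits R \<and>
     (\<forall>u as. tau_factorization R \<tau> a u as \<longrightarrow>
        (\<exists>i < length as. PIdl\<^bsub>R\<^esub> a = PIdl\<^bsub>R\<^esub> (as ! i)))"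

definition tau_atomic_factorization ::
    "('a, 'm) ring_scheme \<Rightarrow> 'a rel \<Rightarrow> 'a \<Rightarrow> 'a \<Rightarrow> 'a list \<Rightarrow> bool" where
  "tau_atomic_factorization R \<tau> a u as \<longleftrightarrow>
     tau_factorization R \<tau> a u as \<and> (\<forall>x \<in> set as. tau_atom R \<tau> x)"

definition tau_atomic_HFR :: "('a, 'm) ring_scheme \<Rightarrow> 'a rel \<Rightarrow> bool" where
  "tau_atomic_HFR R \<tau> \<longleftrightarrow>
     (\<forall>a \<in> nonunits R. \<exists>u as. tau_atomic_factorization R \<tau> a u as) \<and>
     (\<forall>a \<in> nonunits R. \<forall>u as v bs.
        tau_atomic_factorization R \<tau> a u as \<longrightarrow> tau_atomic_factorization R \<tau> a v bs \<longrightarrow>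
        length as = length bs)"

end

(*
  A product of two tau-related factors is zero as soon as tau is contained in tau_z, so a nonzero
  non-unit only has trivial factorizations and is an atom.  Everything therefore hinges on the
  factorizations of zero: the nontrivial ones are the lists of pairwise tau-related elements, all of
  them atomic, and they are stable under passing to sublists.  Hence the half-factorial property
  says exactly that no three elements are pairwise tau-related.  For tau_z_Delta these are triangles
  in the zero-divisor graph; for tau_z repetitions are allowed, so that moreover no nonzero element
  may square to zero.
*)

theory Submission
  imports Defs
begin

section \<open>Clique numbers via complete subgraphs of a given size\<close>

lemma has_complete_subgraph_mono:
  assumes "has_complete_subgraph G r" "s \<le> r"
  shows "has_complete_subgraph G s"
proof -
  obtain C where C: "C \<subseteq> fst G" "finite C" "card C = r" "clique C (snd G)"
    using assms(1) unfolding has_complete_subgraph_def by blast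
  then obtain D where "D \<subseteq> C" "card D = s"
    using assms(2) obtain_subset_with_card_n by metis
  moreover from this C have "finite D" "D \<subseteq> fst G" "clique D (snd G)"
    by (auto simp: clique_def intro: finite_subset)
  ultimately show ?thesis unfolding has_complete_subgraph_def by blast
qed

text \<open>Replaces the three-way definition of the clique number by a test at the single size k +
  1. This suffices because the sizes of complete subgraphs are closed downwards.\<close>

lemma clique_number_le_iff:
  "clique_number G \<le> enat k \<longleftrightarrow> \<not> has_complete_subgraph G (Suc k)"
proof (cases "fst G = {}")
  case True
  then show ?thesis
    by (auto simp: clique_number_def has_complete_subgraph_def zero_enat_def)
next
  case nonempty: False
  show ?thesis
  proof (cases "\<forall>r\<ge>1. has_complete_subgraph G r")
    case True
    then show ?thesis using nonempty by (simp add: clique_number_def)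
  next
    case False
    \<comment> \<open>By monotonicity a missing size bounds all sizes that occur, and a single
      vertex supplies size 1. So the \<open>GREATEST\<close> in the definition is a true
      maximum.\<close>
    then obtain b where "\<not> has_complete_subgraph G b" by blast
    then have bound: "r \<le> b" if "1 \<le> r \<and> has_complete_subgraph G r" for r
      using has_complete_subgraph_mono[of G r b] that by linarith
    obtain v where "v \<in> fst G" using nonempty by blast
    then have "1 \<le> (1::nat) \<and> has_complete_subgraph G 1"
      by (auto simp: has_complete_subgraph_def clique_def intro!: exI[of _ "{v}"])
    then have
      greatest: "1 \<le> (GREATEST r. 1 \<le> r \<and> has_complete_subgraph G r) \<and>
         has_complete_subgraph G (GREATEST r. 1 \<le> r \<and> has_complete_subgraph G r)"
      using bound by (rule GreatestI_nat)
    have "(GREATEST r. 1 \<le> r \<and> has_complete_subgraph G r) \<le> k \<longleftrightarrow>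
        \<not> has_complete_subgraph G (Suc k)" (is "?g \<le> k \<longleftrightarrow> _")
    proof
      assume "?g \<le> k"
      moreover have "Suc k \<le> ?g" if "has_complete_subgraph G (Suc k)"
        using that bound by (intro Greatest_le_nat) auto
      ultimately show "\<not> has_complete_subgraph G (Suc k)" by auto
    next
      assume "\<not> has_complete_subgraph G (Suc k)"
      then show "?g \<le> k"
        using greatest has_complete_subgraph_mono[of G ?g "Suc k"] by linarith
    qed
    then show ?thesis using nonempty False unfolding clique_number_def by (simp only: if_False enat_ord_simps)
  qed
qed

lemma has_complete_subgraph_3_iff:
  "has_complete_subgraph (V, E) 3 \<longleftrightarrow>
     (\<exists>x\<in>V. \<exists>y\<in>V. \<exists>z\<in>V. x \<noteq> y \<and> x \<noteq> z \<and> y \<noteq> z \<and> {x, y} \<in> E \<and> {x, z} \<in> E \<and> {y, z} \<in> E)"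
  (is "?L \<longleftrightarrow> ?R")
proof
  assume ?L
  then obtain x y z where "{x, y, z} \<subseteq> V" "clique {x, y, z} E" "x \<noteq> y" "x \<noteq> z" "y \<noteq> z"
    unfolding has_complete_subgraph_def by (metis card_3_iff fst_conv snd_conv)
  then show ?R by (auto simp: clique_def)
next
  assume ?R
  then obtain x y z where "{x, y, z} \<subseteq> V" "x \<noteq> y" "x \<noteq> z" "y \<noteq> z"
    "{x, y} \<in> E" "{x, z} \<in> E" "{y, z} \<in> E" by auto
  then show ?L
    unfolding has_complete_subgraph_def
    by (intro exI[of _ "{x, y, z}"]) (auto simp: clique_def insert_commute)
qed

section \<open>Factorizations for relations contained in \<open>tau_z\<close>\<close>

context cring
begin

text \<open>A unit a could be cancelled from ab = a0. This is what places adjacent vertices of the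
  zero-divisor graph in the domain of the relations.\<close>

lemma mult_eq_zero_nonunit:
  assumes "a \<in> carrier R" "b \<in> carrier R" "b \<noteq> \<zero>" "a \<otimes> b = \<zero>"
  shows "a \<in> nonunits R"
proof -
  have "a \<notin> Units R"
    using Units_l_cancel[of a b \<zero>] assms by (metis r_null zero_closed)
  then show ?thesis using assms(1) by (simp add: nonunits_def)
qed

lemma nonzero_nonunits_closed: "a \<in> nonzero_nonunits R \<Longrightarrow> a \<in> carrier R"
  by (simp add: nonzero_nonunits_def nonunits_def)

lemma sym_tau_z: "sym (tau_z R)"
  by (rule symI) (simp add: tau_z_def m_comm nonzero_nonunits_closed)

lemma sym_tau_z_Delta: "sym (tau_z_Delta R)"
  using sym_tau_z by (auto simp: sym_def tau_z_def tau_z_Delta_def)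

lemma foldr_mult_closed:
  "set as \<subseteq> carrier R \<Longrightarrow> foldr (\<otimes>) as \<one> \<in> carrier R"
  by (induction as) auto

text \<open>With two or more factors, the first two already multiply to 0, and so the whole product
  vanishes.\<close>

lemma tau_factorization_nonzero_length:
  assumes "\<tau> \<subseteq> tau_z R" "tau_factorization R \<tau> a u as" "a \<noteq> \<zero>"
  shows "length as = 1"
proof (rule ccontr)
  assume "length as \<noteq> 1"
  then obtain x y xs where as: "as = x # y # xs"
    using assms(2) by (cases as rule: remdups_adj.cases) (auto simp: tau_factorization_def)
  have "(as ! 0, as ! 1) \<in> \<tau>"
    using assms(2) as unfolding tau_factorization_def by force
  then have "x \<otimes> y = \<zero>" using assms(1) as by (auto simp: tau_z_def)
  moreover have car: "set as \<subseteq> carrier R" and u: "u \<in> carrier R"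
    using assms(2,3) by (auto simp: tau_factorization_def nonzero_nonunits_def nonunits_def)
  ultimately have "foldr (\<otimes>) as \<one> = \<zero>"
    using as by (simp add: m_assoc[symmetric] foldr_mult_closed)
  then show False using assms(2,3) u by (simp add: tau_factorization_def)
qed

lemma tau_atom_nonzero:
  assumes "\<tau> \<subseteq> tau_z R" "a \<in> nonzero_nonunits R"
  shows "tau_atom R \<tau> a"
  unfolding tau_atom_def
proof (intro conjI allI impI)
  show "a \<in> nonunits R" using assms(2) by (simp add: nonzero_nonunits_def)
next
  fix u as assume f: "tau_factorization R \<tau> a u as"
  have nz: "a \<noteq> \<zero>" using assms(2) by (simp add: nonzero_nonunits_def)
  obtain x where as: "as = [x]"
    using tau_factorization_nonzero_length[OF assms(1) f nz] by (auto simp: length_Suc_conv)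
  have x: "x \<in> carrier R" and u: "u \<in> Units R" and a: "a = u \<otimes> x"
    using f nz as by (auto simp: tau_factorization_def nonzero_nonunits_def nonunits_def)
  have "x = inv u \<otimes> a" using x u a by (simp add: m_assoc[symmetric] Units_closed)
  \<comment> \<open>Each of a and x is a multiple of the other, by u and by its inverse.\<close>
  then have "PIdl a = PIdl x"
    using x u a by (metis Units_closed Units_inv_closed cgenideal_ideal cgenideal_minimal
        cgenideal_self ideal.I_l_closed m_closed subset_antisym)
  then show "\<exists>i<length as. PIdl a = PIdl (as ! i)" using as by auto
qed

lemma tau_factorization_trivial:
  assumes "a \<in> nonunits R"
  shows "tau_factorization R \<tau> a \<one> [a]"
  using assms by (auto simp: tau_factorization_def nonunits_def nonzero_nonunits_def)

lemma tau_factorization_zero_atomic: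
  assumes "\<tau> \<subseteq> tau_z R" "\<zero> \<in> nonunits R" "2 \<le> length as"
    and related: "\<And>i j. i < length as \<Longrightarrow> j < length as \<Longrightarrow> i \<noteq> j \<Longrightarrow> (as ! i, as ! j) \<in> \<tau>"
  shows "tau_atomic_factorization R \<tau> \<zero> \<one> as"
proof -
  obtain x y xs where as: "as = x # y # xs"
    using assms(3) by (cases as rule: remdups_adj.cases) auto
  have mem: "set as \<subseteq> nonzero_nonunits R"
  proof
    fix z assume "z \<in> set as"
    then obtain i where i: "i < length as" "z = as ! i" by (auto simp: in_set_conv_nth)
    \<comment> \<open>Any index different from i will do; one exists since the list has at least two
      entries. Being related to another entry forces z to be a nonzero non-unit.\<close>
    let ?j = "if i = 0 then 1 else 0"
    have "?j < length as" "i \<noteq> ?j"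
      using assms(3) by auto
    then have "(z, as ! ?j) \<in> tau_z R" using related i assms(1) by blast
    then show "z \<in> nonzero_nonunits R" by (simp add: tau_z_def)
  qed
  then have car: "set as \<subseteq> carrier R" by (auto simp: nonzero_nonunits_def nonunits_def)
  have "x \<otimes> y = \<zero>" using related[of 0 1] as assms(1) by (auto simp: tau_z_def)
  then have "foldr (\<otimes>) as \<one> = \<zero>"
    using as car by (simp add: m_assoc[symmetric] foldr_mult_closed)
  then have "tau_factorization R \<tau> \<zero> \<one> as"
    using mem related assms(2,3) by (auto simp: tau_factorization_def)
  then show ?thesis
    using mem tau_atom_nonzero[OF assms(1)] by (auto simp: tau_atomic_factorization_def)
qed

text \<open>Decides whether the trivial factorization of 0 is atomic. A related pair gives 0 = xy,
  where neither factor generates the zero ideal; without related pairs only factorizations of length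
  1 remain. Symmetry is used because a factorization asks for the relation in both orders.\<close>

lemma tau_atom_zero_iff:
  assumes "\<tau> \<subseteq> tau_z R" "sym \<tau>" "\<zero> \<in> nonunits R"
  shows "tau_atom R \<tau> \<zero> \<longleftrightarrow> \<tau> = {}"
proof
  assume atom: "tau_atom R \<tau> \<zero>"
  show "\<tau> = {}"
  proof (rule ccontr)
    assume "\<tau> \<noteq> {}"
    then obtain x y where xy: "(x, y) \<in> \<tau>" by auto
    then have "(y, x) \<in> \<tau>" using assms(2) by (auto dest: symD)
    with xy have "tau_atomic_factorization R \<tau> \<zero> \<one> [x, y]"
      by (intro tau_factorization_zero_atomic assms(1,3)) (auto simp: less_Suc_eq)
    then have "tau_factorization R \<tau> \<zero> \<one> [x, y]"
      by (simp add: tau_atomic_factorization_def)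
    then obtain v where v: "v \<in> set [x, y]" "PIdl \<zero> = PIdl v"
      using atom unfolding tau_atom_def by (meson nth_mem)
    then have "v \<in> carrier R" "v \<noteq> \<zero>"
      using xy assms(1) by (auto simp: tau_z_def nonzero_nonunits_def nonunits_def)
    moreover from this have "v \<in> PIdl \<zero>" using cgenideal_self v(2) by simp
    then have "v = \<zero>" by (auto simp: cgenideal_def)
    ultimately show False by simp
  qed
next
  assume empty: "\<tau> = {}"
  show "tau_atom R \<tau> \<zero>"
    unfolding tau_atom_def
  proof (intro conjI allI impI)
    fix u as assume f: "tau_factorization R \<tau> \<zero> u as"
    have "length as = 1"
    proof (rule ccontr)
      assume "length as \<noteq> 1"
      then have "1 < length as" using f by (simp add: tau_factorization_def)
      then have "(as ! 0, as ! 1) \<in> \<tau>" using f unfolding tau_factorization_def by force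
      with empty show False by simp
    qed
    then obtain x where as: "as = [x]" by (auto simp: length_Suc_conv)
    then have x: "x \<in> carrier R" and u: "u \<in> Units R" and z: "u \<otimes> x = \<zero>"
      using f by (auto simp: tau_factorization_def nonzero_nonunits_def nonunits_def)
    then have "x = \<zero>" using Units_l_cancel[of u x \<zero>] by (simp add: Units_closed)
    with as show "\<exists>i<length as. PIdl \<zero> = PIdl (as ! i)" by simp
  qed (rule assms(3))
qed

lemma tau_atomic_HFR_iff_no_triple:
  assumes "\<tau> \<subseteq> tau_z R" "sym \<tau>"
  shows "tau_atomic_HFR R \<tau> \<longleftrightarrow> \<not> (\<exists>x y z. (x, y) \<in> \<tau> \<and> (x, z) \<in> \<tau> \<and> (y, z) \<in> \<tau>)"
proof (cases "\<zero> \<in> nonunits R")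
  \<comment> \<open>If 0 is a unit, the ring is zero and has no non-units, so both sides hold
    vacuously.\<close>
  case False
  then have "carrier R = {\<zero>}"
    by (metis DiffI Units_r_inv_ex carrier_one_zero l_null nonunits_def zero_closed)
  then have "nonunits R = {}" using False by (auto simp: nonunits_def)
  then show ?thesis
    using assms(1) by (auto simp: tau_atomic_HFR_def tau_z_def nonzero_nonunits_def)
next
  case zero: True
  show ?thesis
  proof
    assume hfr: "tau_atomic_HFR R \<tau>"
    show "\<not> (\<exists>x y z. (x, y) \<in> \<tau> \<and> (x, z) \<in> \<tau> \<and> (y, z) \<in> \<tau>)"
    proof
      assume "\<exists>x y z. (x, y) \<in> \<tau> \<and> (x, z) \<in> \<tau> \<and> (y, z) \<in> \<tau>"
      then obtain x y z where r: "(x, y) \<in> \<tau>" "(x, z) \<in> \<tau>" "(y, z) \<in> \<tau>" by auto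
      with assms(2) have s: "(y, x) \<in> \<tau>" "(z, x) \<in> \<tau>" "(z, y) \<in> \<tau>" by (auto dest: symD)
      \<comment> \<open>The triple and its first two entries give atomic factorizations of 0 of
        lengths 3 and 2. The entries need not be distinct.\<close>
      have "tau_atomic_factorization R \<tau> \<zero> \<one> [x, y]"
        using r s by (intro tau_factorization_zero_atomic assms(1) zero) (auto simp: less_Suc_eq)
      moreover have "tau_atomic_factorization R \<tau> \<zero> \<one> [x, y, z]"
        using r s by (intro tau_factorization_zero_atomic assms(1) zero) (auto simp: less_Suc_eq)
      ultimately have "length [x, y] = length [x, y, z]"
        using hfr zero unfolding tau_atomic_HFR_def by blast
      then show False by simp
    qed
  next
    assume no_triple: "\<not> (\<exists>x y z. (x, y) \<in> \<tau> \<and> (x, z) \<in> \<tau> \<and> (y, z) \<in> \<tau>)"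
    show "tau_atomic_HFR R \<tau>"
      unfolding tau_atomic_HFR_def
    proof (intro conjI ballI allI impI)
      fix a assume a: "a \<in> nonunits R"
      show "\<exists>u as. tau_atomic_factorization R \<tau> a u as"
      proof (cases "tau_atom R \<tau> a")
        case True
        then have "tau_atomic_factorization R \<tau> a \<one> [a]"
          using tau_factorization_trivial[OF a] by (simp add: tau_atomic_factorization_def)
        then show ?thesis by blast
      next
        case False
        \<comment> \<open>Only 0 can fail to be an atom, and then a related pair exists and factors
          it.\<close>
        then have "a = \<zero>"
          using a tau_atom_nonzero[OF assms(1)] by (auto simp: nonzero_nonunits_def)
        moreover obtain x y where "(x, y) \<in> \<tau>" "(y, x) \<in> \<tau>"
          using False tau_atom_zero_iff[OF assms zero] \<open>a = \<zero>\<close> assms(2) by (auto dest: symD)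
        then have "tau_atomic_factorization R \<tau> \<zero> \<one> [x, y]"
          by (intro tau_factorization_zero_atomic assms(1) zero) (auto simp: less_Suc_eq)
        ultimately show ?thesis by blast
      qed
    next
      \<comment> \<open>The length depends only on a and the relation, which gives uniqueness at
        once.\<close>
      have length: "length as = (if a = \<zero> \<and> \<tau> \<noteq> {} then 2 else 1)"
        if af: "tau_atomic_factorization R \<tau> a u as" for a u as
      proof -
        have f: "tau_factorization R \<tau> a u as" and atoms: "\<forall>x\<in>set as. tau_atom R \<tau> x"
          using af by (auto simp: tau_atomic_factorization_def)
        have related: "(as ! i, as ! j) \<in> \<tau>"
          if "i < length as" "j < length as" "i \<noteq> j" for i j
          using f that by (simp add: tau_factorization_def)
        have pos: "1 \<le> length as" using f by (simp add: tau_factorization_def)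
        have "length as \<le> 2"
        proof (rule ccontr)
          assume "\<not> length as \<le> 2"
          then have "(as ! 0, as ! 1) \<in> \<tau>" "(as ! 0, as ! 2) \<in> \<tau>" "(as ! 1, as ! 2) \<in> \<tau>"
            by (auto intro: related)
          with no_triple show False by blast
        qed
        \<comment> \<open>A single factor of 0 is itself 0, which is not an atom once some pair is
          related.\<close>
        moreover have "length as \<noteq> 1" if "a = \<zero>" "\<tau> \<noteq> {}"
        proof
          assume "length as = 1"
          then obtain x where as: "as = [x]" by (auto simp: length_Suc_conv)
          then have "x \<in> carrier R" "u \<in> Units R" "u \<otimes> x = \<zero>"
            using f that zero
            by (auto simp: tau_factorization_def nonzero_nonunits_def nonunits_def)
          then have "x = \<zero>" using Units_l_cancel[of u x \<zero>] by (simp add: Units_closed)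
          then have "tau_atom R \<tau> \<zero>" using atoms as by simp
          then show False using that tau_atom_zero_iff[OF assms zero] by simp
        qed
        moreover have "length as = 1" if "a \<noteq> \<zero>"
          using tau_factorization_nonzero_length[OF assms(1) f that] .
        moreover have "length as = 1" if "\<tau> = {}"
          using related[of 0 1] pos that by force
        ultimately show ?thesis using pos by (cases "a = \<zero> \<and> \<tau> \<noteq> {}") force+
      qed
      fix a u as v bs
      assume "tau_atomic_factorization R \<tau> a u as" "tau_atomic_factorization R \<tau> a v bs"
      then show "length as = length bs" using length by simp
    qed
  qed
qed

section \<open>Triangles in the zero-divisor graph\<close>

lemma clique_number_zero_divisor_graph_le_2_iff:
  "clique_number (zero_divisor_graph R) \<le> 2 \<longleftrightarrow>
     \<not> (\<exists>x y z. (x, y) \<in> tau_z_Delta R \<and> (x, z) \<in> tau_z_Delta R \<and> (y, z) \<in> tau_z_Delta R)"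
proof -
  let ?V = "zero_divisors R - {\<zero>}"
  let ?E = "{{a, b} | a b. a \<in> ?V \<and> b \<in> ?V \<and> a \<noteq> b \<and> a \<otimes> b = \<zero>}"
  have vertex: "x \<in> carrier R \<and> x \<noteq> \<zero>" if "x \<in> ?V" for x
    using that by (auto simp: zero_divisors_def)
  \<comment> \<open>Edges are unordered, so commutativity enters here. A vertex on no edge may lie
    outside the relation, but triangles do not see it.\<close>
  have edge: "{x, y} \<in> ?E \<longleftrightarrow> (x, y) \<in> tau_z_Delta R" for x y
  proof
    assume "{x, y} \<in> ?E"
    then have "x \<in> carrier R" "y \<in> carrier R" "x \<noteq> \<zero>" "y \<noteq> \<zero>" "x \<noteq> y" "x \<otimes> y = \<zero>"
      using vertex by (auto simp: doubleton_eq_iff m_comm)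
    then show "(x, y) \<in> tau_z_Delta R"
      using mult_eq_zero_nonunit[of x y] mult_eq_zero_nonunit[of y x]
      by (auto simp: tau_z_Delta_def nonzero_nonunits_def m_comm)
  next
    assume "(x, y) \<in> tau_z_Delta R"
    then have xy: "x \<in> carrier R" "y \<in> carrier R" "x \<noteq> \<zero>" "y \<noteq> \<zero>" "x \<noteq> y" "x \<otimes> y = \<zero>"
      by (auto simp: tau_z_Delta_def nonzero_nonunits_def nonunits_def)
    then have "y \<otimes> x = \<zero>" by (simp add: m_comm)
    with xy have "x \<in> ?V" "y \<in> ?V" by (auto simp: zero_divisors_def)
    with xy show "{x, y} \<in> ?E" by blast
  qed
  \<comment> \<open>Recovers from the relation the vertex and distinctness conditions in the
    description of complete subgraphs on three vertices.\<close>
  have ends: "x \<in> ?V \<and> y \<in> ?V \<and> x \<noteq> y" if "(x, y) \<in> tau_z_Delta R" for x y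
    using that[folded edge] by (auto simp: doubleton_eq_iff)
  have "clique_number (zero_divisor_graph R) \<le> 2 \<longleftrightarrow>
      \<not> has_complete_subgraph (?V, ?E) 3"
    using clique_number_le_iff[of "zero_divisor_graph R" 2]
    by (simp add: zero_divisor_graph_def Let_def numeral_eq_enat eval_nat_numeral)
  also have "\<dots> \<longleftrightarrow> \<not> (\<exists>x y z. (x, y) \<in> tau_z_Delta R \<and> (x, z) \<in> tau_z_Delta R \<and>
      (y, z) \<in> tau_z_Delta R)"
    unfolding has_complete_subgraph_3_iff edge using ends by blast
  finally show ?thesis .
qed

section \<open>Reduced rings and the diagonal of \<open>tau_z\<close>\<close>

lemma reduced_iff_square:
  "reduced R \<longleftrightarrow> (\<forall>a\<in>carrier R. a \<otimes> a = \<zero> \<longrightarrow> a = \<zero>)"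
proof
  assume red: "reduced R"
  show "\<forall>a\<in>carrier R. a \<otimes> a = \<zero> \<longrightarrow> a = \<zero>"
  proof (intro ballI impI)
    fix a assume "a \<in> carrier R" "a \<otimes> a = \<zero>"
    moreover from this have "a [^] (2::nat) = \<zero>" by (simp add: numeral_2_eq_2)
    ultimately show "a = \<zero>" using red unfolding reduced_def by blast
  qed
next
  assume sq: "\<forall>a\<in>carrier R. a \<otimes> a = \<zero> \<longrightarrow> a = \<zero>"
  have "a = \<zero>" if "a \<in> carrier R" "a [^] n = \<zero>" for a and n :: nat
    using that(2)
  proof (induction n)
    case 0
    \<comment> \<open>Here the hypothesis reads 1 = 0, so the ring is zero.\<close>
    then show ?case using that(1) by (metis nat_pow_0 l_one l_null)
  next
    case (Suc n)
    \<comment> \<open>The exponent is lowered by one: 2n = (n + 1) + (n - 1) makes the square of a^n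
      a multiple of a^(n+1) = 0. The truncated n - 1 requires n > 0; for n = 0 the hypothesis is
      already a = 0.\<close>
    have "a [^] n \<otimes> a [^] n = \<zero>" if "n \<noteq> 0"
    proof -
      have "n + n = Suc n + (n - 1)" using that by simp
      then have "a [^] n \<otimes> a [^] n = a [^] Suc n \<otimes> a [^] (n - 1)"
        by (simp only: nat_pow_mult \<open>a \<in> carrier R\<close>)
      also have "\<dots> = \<zero>"
        using \<open>a \<in> carrier R\<close> unfolding Suc.prems by simp
      finally show ?thesis .
    qed
    then have "n \<noteq> 0 \<Longrightarrow> a [^] n = \<zero>" using sq \<open>a \<in> carrier R\<close> by blast
    then show ?case using Suc \<open>a \<in> carrier R\<close> by (cases "n = 0") simp_all
  qed
  then show "reduced R" by (auto simp: reduced_def)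
qed

lemma reduced_iff_irrefl_tau_z: "reduced R \<longleftrightarrow> irrefl (tau_z R)"
proof -
  have "(a, a) \<in> tau_z R \<longleftrightarrow> a \<in> carrier R \<and> a \<otimes> a = \<zero> \<and> a \<noteq> \<zero>" for a
    using mult_eq_zero_nonunit[of a a]
    by (auto simp: tau_z_def nonzero_nonunits_def nonunits_def)
  then show ?thesis by (auto simp: reduced_iff_square irrefl_def)
qed

text \<open>A loop at x yields the triple x, x, x, so the absence of triples forces irreflexivity,
  that is, reducedness. Once there are no loops, \<open>tau_z\<close> and \<open>tau_z_Delta\<close>
  coincide.\<close>

lemma no_triple_tau_z_iff:
  "\<not> (\<exists>x y z. (x, y) \<in> tau_z R \<and> (x, z) \<in> tau_z R \<and> (y, z) \<in> tau_z R) \<longleftrightarrow>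
     reduced R \<and>
     \<not> (\<exists>x y z. (x, y) \<in> tau_z_Delta R \<and> (x, z) \<in> tau_z_Delta R \<and> (y, z) \<in> tau_z_Delta R)"
proof -
  have "tau_z_Delta R = tau_z R - Id" by (auto simp: tau_z_Delta_def tau_z_def)
  then show ?thesis unfolding reduced_iff_irrefl_tau_z irrefl_def by blast
qed

end

theorem theorem5p12:
  fixes R :: "('a, 'm) ring_scheme"
  assumes "cring R"
  shows "(tau_atomic_HFR R (tau_z_Delta R) \<longleftrightarrow> clique_number (zero_divisor_graph R) \<le> 2) \<and>
         (tau_atomic_HFR R (tau_z R) \<longleftrightarrow>
            reduced R \<and> clique_number (zero_divisor_graph R) \<le> 2)"
proof -
  interpret cring R by (rule assms)
  have "tau_z_Delta R \<subseteq> tau_z R" by (auto simp: tau_z_Delta_def tau_z_def)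
  then show ?thesis
    by (simp only: tau_atomic_HFR_iff_no_triple sym_tau_z sym_tau_z_Delta subset_refl
        clique_number_zero_divisor_graph_le_2_iff no_triple_tau_z_iff simp_thms)
qed

end
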